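(* Let $(A,[-,-]_A)$ be a Leibniz algebra and $r=\sum_i a_i\otimes b_i\in A\otimes A$. Let $\Delta_r:A\to A\otimes A$ be the co-multiplication $\Delta_r(x)=F(x)r$, $x\in A$. Then $(A,[-,-]_A,\Delta_r)$ is a Leibniz bialgebra if and only if the following three equations hold for all $x,y\in A$: \[ \begin{aligned} &\Big(\mathrm{id}\otimes\mathrm{id}\otimes\mathcal{R}_A(x)-\mathrm{id}\otimes(\mathcal{L}_A+\mathcal{R}_A)(x)\otimes\mathrm{id}\Big)\Big((\sigma\otimes\mathrm{id})[[r,r]]-\sum_j F(a_j)(r-\sigma(r))\otimes b_j\Big)\\ &+\Big((\mathcal{L}_A+\mathcal{R}_A)(x)\otimes\mathrm{id}\otimes\mathrm{id}\Big)[[r,r]]\\ &+\sum_j\Big((\mathcal{L}_A+\mathcal{R}_A)(a_j)\otimes\mathrm{id}\otimes\mathrm{id}\Big)\Big(\sigma\big(F(x)(r-\sigma(r))\big)\otimes b_j\Big)=0, \end{aligned} \] \[ (\mathcal{R}_A(y)\otimes\mathrm{id})F(x)(r-\sigma(r))=0, \] \[ \begin{aligned} &(\mathcal{L}_A(y)\otimes\mathrm{id})\sigma\big(F(x)(r-\sigma(r))\big)+(\mathcal{R}_A(y)\otimes\mathrm{id})(\sigma-\mathrm{id})\big(F(x)(r-\sigma(r))\big)\\ &-\sigma(\mathcal{R}_A(y)\otimes\mathrm{id})F(x)(r-\sigma(r))-\sigma(\mathcal{R}_A(x)\otimes\mathrm{id})F(y)(r-\sigma(r))=0. \end{aligned}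 \] In particular, if $r$ is a solution of the classical Leibniz Yang-Baxter equation in $(A,[-,-]_A)$ (that is, $[[r,r]]=0$) and the skew-symmetric part $\frac12(r-\sigma(r))$ is invariant, that is, $F(x)(r-\sigma(r))=0$ for all $x\in A$, then $(A,[-,-]_A,\Delta_r)$ is a Leibniz bialgebra.
   Context: All vector spaces and algebras are finite-dimensional over an algebraically closed field $\mathbb{K}$ of characteristic zero. A (left) Leibniz algebra is a vector space $A$ with a bilinear multiplication $[-,-]_A$ satisfying $[x,[y,z]_A]_A=[[x,y]_A,z]_A+[y,[x,z]_A]_A$ for all $x,y,z\in A$. Define $\mathcal{L}_A,\mathcal{R}_A:A\to\mathrm{End}(A)$ by $\mathcal{L}_A(x)y=[x,y]_A=\mathcal{R}_A(y)x$. The flip is $\sigma(x\otimes y)=y\otimes x$. For $x\in A$ put $F(x)=(\mathcal{L}_A+\mathcal{R}_A)(x)\otimes\mathrm{id}-\mathrm{id}\otimes\mathcal{R}_A(x)\in\mathrm{End}(A\otimes A)$. For $r=\sum_i a_i\otimes b_i$ put \[ [[r,r]]=\sum_{i,j}\Big([a_i,a_j]_A\otimes b_i\otimes b_j-a_i\otimes([b_i,a_j]_A+[a_j,b_i]_A)\otimes b_j+a_i\otimes a_j\otimes[b_j,b_i]_A\Big)\in A\otimes A\otimes A. \] A Leibniz coalgebra is a vector space $A$ with a linear map $\Delta:A\to A\otimes A$ such that $(\Delta\otimes\mathrm{id})\Delta(x)+(\sigma\otimes\mathrm{id})(\mathrm{id}\otimes\Delta)\Delta(x)-(\mathrm{id}\otimes\Delta)\Delta(x)=0$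 for all $x\in A$. A Leibniz bialgebra is a triple $(A,[-,-]_A,\Delta)$ such that $(A,[-,-]_A)$ is a Leibniz algebra, $(A,\Delta)$ is a Leibniz coalgebra, and for all $x,y\in A$: \[ \sigma(\mathcal{R}_A(y)\otimes\mathrm{id})\Delta(x)=(\mathcal{R}_A(x)\otimes\mathrm{id})\Delta(y), \] \[ \Delta([x,y]_A)=\big(\mathrm{id}\otimes\mathcal{R}_A(y)-(\mathcal{L}_A+\mathcal{R}_A)(y)\otimes\mathrm{id}\big)(\mathrm{id}+\sigma)\Delta(x)+\big(\mathrm{id}\otimes\mathcal{L}_A(x)+\mathcal{L}_A(x)\otimes\mathrm{id}\big)\Delta(y). \] *)

theory Defs
  imports "HOL-Computational_Algebra.Polynomial"
begin

definition bilinear_map ::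
    "('k::field \<Rightarrow> 'a::ab_group_add \<Rightarrow> 'a) \<Rightarrow> ('k \<Rightarrow> 'b::ab_group_add \<Rightarrow> 'b) \<Rightarrow>
     ('k \<Rightarrow> 'c::ab_group_add \<Rightarrow> 'c) \<Rightarrow> ('a \<Rightarrow> 'b \<Rightarrow> 'c) \<Rightarrow> bool"
  where "bilinear_map sA sB sC \<phi> \<longleftrightarrow>
    (\<forall>x. Vector_Spaces.linear sB sC (\<phi> x)) \<and>
    (\<forall>y. Vector_Spaces.linear sA sC (\<lambda>x. \<phi> x y))"

text \<open>
  A tensor product is a space with a universal bilinear map. HOL cannot quantify over the types of
  all target spaces inside a definition, so the universal property is required for bilinear forms
  only; the theorem tensor_product_universal below derives it for every target space.
\<close>

definition is_tensor_product ::
    "('k::field \<Rightarrow> 'a::ab_group_add \<Rightarrow> 'a) \<Rightarrow> ('k \<Rightarrow> 'b::ab_group_add \<Rightarrow> 'b) \<Rightarrow>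
     ('k \<Rightarrow> 't::ab_group_add \<Rightarrow> 't) \<Rightarrow> ('a \<Rightarrow> 'b \<Rightarrow> 't) \<Rightarrow> bool"
  where "is_tensor_product sA sB sT ten \<longleftrightarrow>
    bilinear_map sA sB sT ten \<and>
    (\<forall>\<phi>. bilinear_map sA sB (*) \<phi> \<longrightarrow>
      (\<exists>!h. Vector_Spaces.linear sT (*) h \<and> (\<forall>x y. h (ten x y) = \<phi> x y)))"

lemma tensor_product_span:
  assumes tp: "is_tensor_product sA sB sT ten"
  shows "module.span sT {ten x y |x y. True} = UNIV"
proof (rule ccontr)
  from tp have bil: "bilinear_map sA sB sT ten"
    and univ: "\<And>\<phi>. bilinear_map sA sB (*) \<phi> \<Longrightarrow>
      \<exists>!h. Vector_Spaces.linear sT (*) h \<and> (\<forall>x y. h (ten x y) = \<phi> x y)"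
    by (auto simp: is_tensor_product_def)
  have lin1: "Vector_Spaces.linear sB sT (ten x)" for x
    using bil by (simp add: bilinear_map_def)
  have lin2: "Vector_Spaces.linear sA sT (\<lambda>x. ten x y)" for y
    using bil by (simp add: bilinear_map_def)
  interpret A: vector_space sA using lin2 by (meson Vector_Spaces.linear_def)
  interpret B: vector_space sB using lin1 by (meson Vector_Spaces.linear_def)
  interpret T: vector_space sT using lin1 by (meson Vector_Spaces.linear_def)
  interpret K: vector_space "(*) :: 'a \<Rightarrow> 'a \<Rightarrow> 'a"
    by unfold_locales (simp_all add: algebra_simps)
  interpret AK: vector_space_pair sA "(*) :: 'a \<Rightarrow> 'a \<Rightarrow> 'a" ..
  interpret BK: vector_space_pair sB "(*) :: 'a \<Rightarrow> 'a \<Rightarrow> 'a" ..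
  interpret TK: vector_space_pair sT "(*) :: 'a \<Rightarrow> 'a \<Rightarrow> 'a" ..
  let ?S = "{ten x y |x y. True}"
  assume "module.span sT ?S \<noteq> UNIV"
  then obtain v where v: "v \<notin> T.span ?S" by auto
  obtain C where C: "C \<subseteq> ?S" "T.independent C" "?S \<subseteq> T.span C"
    using T.maximal_independent_subset by blast
  have "v \<notin> T.span C" using v C(1) T.span_mono by blast
  then have ind: "T.independent (insert v C)" and vC: "v \<notin> C"
    using C(2) T.independent_insertI T.span_base by blast+
  obtain g where g: "Vector_Spaces.linear sT (*) g"
    "\<forall>c\<in>insert v C. g c = (if c = v then 1 else 0)"
    using TK.linear_independent_extend[OF ind, of "\<lambda>c. if c = v then 1 else 0"] by blast
  have g0: "g s = 0" if "s \<in> T.span C" for s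
  proof (rule TK.linear_eq_0_on_span[OF g(1) _ that])
    show "g x = 0" if "x \<in> C" for x using g(2) vC that by auto
  qed
  have "bilinear_map sA sB (*) (\<lambda>x y. 0::'a)"
    by (simp add: bilinear_map_def AK.linear_0 BK.linear_zero AK.linear_zero)
  from univ[OF this] have "g = (\<lambda>x. 0)"
    using g g0 C(3) TK.linear_zero by blast
  then show False using g(2) by (metis insertI1 zero_neq_one)
qed

theorem tensor_product_universal:
  fixes sW :: "'k::field \<Rightarrow> 'w::ab_group_add \<Rightarrow> 'w"
  assumes tp: "is_tensor_product sA sB sT ten"
    and \<phi>: "bilinear_map sA sB sW \<phi>"
  shows "\<exists>!h. Vector_Spaces.linear sT sW h \<and> (\<forall>x y. h (ten x y) = \<phi> x y)"
proof -
  from tp have bil: "bilinear_map sA sB sT ten"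
    and univ: "\<And>\<phi>. bilinear_map sA sB (*) \<phi> \<Longrightarrow>
      \<exists>!h. Vector_Spaces.linear sT (*) h \<and> (\<forall>x y. h (ten x y) = \<phi> x y)"
    by (auto simp: is_tensor_product_def)
  have lin1: "Vector_Spaces.linear sB sT (ten x)" "Vector_Spaces.linear sB sW (\<phi> x)" for x
    using bil \<phi> by (simp_all add: bilinear_map_def)
  have lin2: "Vector_Spaces.linear sA sW (\<lambda>x. \<phi> x y)" for y
    using \<phi> by (simp add: bilinear_map_def)
  interpret T: vector_space sT using lin1 by (meson Vector_Spaces.linear_def)
  interpret W: vector_space sW using lin1 by (meson Vector_Spaces.linear_def)
  interpret K: vector_space "(*) :: 'k \<Rightarrow> 'k \<Rightarrow> 'k"
    by unfold_locales (simp_all add: algebra_simps)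
  interpret TW: vector_space_pair sT sW ..
  interpret TK: vector_space_pair sT "(*) :: 'k \<Rightarrow> 'k \<Rightarrow> 'k" ..
  interpret WK: vector_space_pair sW "(*) :: 'k \<Rightarrow> 'k \<Rightarrow> 'k" ..
  let ?S = "{ten x y |x y. True}"
  have span: "T.span ?S = UNIV" by (rule tensor_product_span[OF tp])
  obtain C where C: "C \<subseteq> ?S" "T.independent C" "?S \<subseteq> T.span C"
    using T.maximal_independent_subset by blast
  have spanC: "T.span C = UNIV"
    using C(3) span T.span_mono[OF C(3)] by (simp add: T.span_span top.extremum_unique)
  have "\<forall>c\<in>C. \<exists>p. c = ten (fst p) (snd p)" using C(1) by fastforce
  then obtain p where p: "\<And>c. c \<in> C \<Longrightarrow> c = ten (fst (p c)) (snd (p c))" by metis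
  obtain h where h: "Vector_Spaces.linear sT sW h"
    "\<forall>c\<in>C. h c = \<phi> (fst (p c)) (snd (p c))"
    using TW.linear_independent_extend[OF C(2), of "\<lambda>c. \<phi> (fst (p c)) (snd (p c))"] by auto
  have h\<phi>: "h (ten x y) = \<phi> x y" for x y
  proof (rule ccontr)
    define w where "w = h (ten x y) - \<phi> x y"
    assume "h (ten x y) \<noteq> \<phi> x y"
    then have "W.independent {w}" by (simp add: w_def)
    then obtain l where l: "Vector_Spaces.linear sW (*) l" "l w = 1"
      using WK.linear_independent_extend[of "{w}" "\<lambda>_. 1"] by auto
    have "bilinear_map sA sB (*) (\<lambda>x y. l (\<phi> x y))"
      using Vector_Spaces.linear_compose[OF lin1(2) l(1)] Vector_Spaces.linear_compose[OF lin2 l(1)]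
      by (simp add: bilinear_map_def o_def)
    from univ[OF this] obtain g where g: "Vector_Spaces.linear sT (*) g"
      "\<And>x y. g (ten x y) = l (\<phi> x y)" by blast
    have "l (h c) = g c" if "c \<in> C" for c
      using p[OF that] h(2) that g(2) by metis
    then have "(l \<circ> h) t = g t" for t
      using TK.linear_eq_on_span[OF Vector_Spaces.linear_compose[OF h(1) l(1)] g(1), of C t] spanC by auto
    then have "l (h (ten x y)) = l (\<phi> x y)" using g(2) by simp
    then have "l w = 0" unfolding w_def using WK.linear_diff[OF l(1)] by simp
    then show False using l(2) by simp
  qed
  show ?thesis
  proof (rule ex1I[of _ h])
    show "Vector_Spaces.linear sT sW h \<and> (\<forall>x y. h (ten x y) = \<phi> x y)" using h h\<phi> by blast
  next
    fix f assume f: "Vector_Spaces.linear sT sW f \<and> (\<forall>x y. f (ten x y) = \<phi> x y)"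
    have "f t = h t" for t
    proof (rule TW.linear_eq_on_span[of f h ?S t])
      show "f z = h z" if "z \<in> ?S" for z using that f h\<phi> by auto
    qed (use f h span in auto)
    then show "f = h" by blast
  qed
qed

text \<open>
  The linear map on the tensor product induced by a bilinear map (meaningful only for bilinear
  arguments).
\<close>

definition tensor_lift ::
    "('k::field \<Rightarrow> 't::ab_group_add \<Rightarrow> 't) \<Rightarrow> ('k \<Rightarrow> 'w::ab_group_add \<Rightarrow> 'w) \<Rightarrow>
     ('a \<Rightarrow> 'b \<Rightarrow> 't) \<Rightarrow> ('a \<Rightarrow> 'b \<Rightarrow> 'w) \<Rightarrow> 't \<Rightarrow> 'w"
  where "tensor_lift sT sW ten \<phi> =
    (THE h. Vector_Spaces.linear sT sW h \<and> (\<forall>x y. h (ten x y) = \<phi> x y))"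

text \<open>
  A space A together with its tensor square and its tensor cube. The cube is realised as
  (A \<otimes> A) \<otimes> A, so that x \<otimes> y \<otimes> z is literally (x \<otimes> y) \<otimes> z; the other bracketing enters through
  tensor_left. The three types are the whole spaces and carry arbitrary scalar multiplications.
\<close>

record ('k, 'a, 't, 'u) tensor_spaces =
  scale1 :: "'k \<Rightarrow> 'a \<Rightarrow> 'a"
  scale2 :: "'k \<Rightarrow> 't \<Rightarrow> 't"
  scale3 :: "'k \<Rightarrow> 'u \<Rightarrow> 'u"
  tensor2 :: "'a \<Rightarrow> 'a \<Rightarrow> 't"  (infixl \<open>\<otimes>\<^sub>2\<index>\<close> 70)
  tensor3 :: "'t \<Rightarrow> 'a \<Rightarrow> 'u"  (infixl \<open>\<otimes>\<^sub>3\<index>\<close> 70)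

definition fd_tensor_spaces ::
    "('k::field, 'a::ab_group_add, 't::ab_group_add, 'u::ab_group_add) tensor_spaces \<Rightarrow> bool"
  where "fd_tensor_spaces V \<longleftrightarrow>
    (\<exists>Basis. finite_dimensional_vector_space (scale1 V) Basis) \<and>
    is_tensor_product (scale1 V) (scale1 V) (scale2 V) (tensor2 V) \<and>
    is_tensor_product (scale2 V) (scale1 V) (scale3 V) (tensor3 V)"

definition tensor_map2 ::
    "('k::field, 'a::ab_group_add, 't::ab_group_add, 'u::ab_group_add) tensor_spaces \<Rightarrow>
     ('a \<Rightarrow> 'a) \<Rightarrow> ('a \<Rightarrow> 'a) \<Rightarrow> 't \<Rightarrow> 't"
  where "tensor_map2 V f g =
    tensor_lift (scale2 V) (scale2 V) (tensor2 V) (\<lambda>x y. f x \<otimes>\<^sub>2\<^bsub>V\<^esub> g y)"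

definition tensor_map3 ::
    "('k::field, 'a::ab_group_add, 't::ab_group_add, 'u::ab_group_add) tensor_spaces \<Rightarrow>
     ('a \<Rightarrow> 'a) \<Rightarrow> ('a \<Rightarrow> 'a) \<Rightarrow> ('a \<Rightarrow> 'a) \<Rightarrow> 'u \<Rightarrow> 'u"
  where "tensor_map3 V f g h =
    tensor_lift (scale3 V) (scale3 V) (tensor3 V) (\<lambda>t z. tensor_map2 V f g t \<otimes>\<^sub>3\<^bsub>V\<^esub> h z)"

definition flip ::
    "('k::field, 'a::ab_group_add, 't::ab_group_add, 'u::ab_group_add) tensor_spaces \<Rightarrow> 't \<Rightarrow> 't"
  where "flip V = tensor_lift (scale2 V) (scale2 V) (tensor2 V) (\<lambda>x y. y \<otimes>\<^sub>2\<^bsub>V\<^esub> x)"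

definition flip_id ::
    "('k::field, 'a::ab_group_add, 't::ab_group_add, 'u::ab_group_add) tensor_spaces \<Rightarrow> 'u \<Rightarrow> 'u"
  where "flip_id V =
    tensor_lift (scale3 V) (scale3 V) (tensor3 V) (\<lambda>t z. flip V t \<otimes>\<^sub>3\<^bsub>V\<^esub> z)"

text \<open>The tensor x \<otimes> t for t in A \<otimes> A, determined by x \<otimes> (y \<otimes> z) = (x \<otimes> y) \<otimes> z.\<close>

definition tensor_left ::
    "('k::field, 'a::ab_group_add, 't::ab_group_add, 'u::ab_group_add) tensor_spaces \<Rightarrow>
     'a \<Rightarrow> 't \<Rightarrow> 'u"
  where "tensor_left V x =
    tensor_lift (scale2 V) (scale3 V) (tensor2 V) (\<lambda>y z. x \<otimes>\<^sub>2\<^bsub>V\<^esub> y \<otimes>\<^sub>3\<^bsub>V\<^esub> z)"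

definition comul_id ::
    "('k::field, 'a::ab_group_add, 't::ab_group_add, 'u::ab_group_add) tensor_spaces \<Rightarrow>
     ('a \<Rightarrow> 't) \<Rightarrow> 't \<Rightarrow> 'u"
  where "comul_id V \<Delta> =
    tensor_lift (scale2 V) (scale3 V) (tensor2 V) (\<lambda>x y. \<Delta> x \<otimes>\<^sub>3\<^bsub>V\<^esub> y)"

definition id_comul ::
    "('k::field, 'a::ab_group_add, 't::ab_group_add, 'u::ab_group_add) tensor_spaces \<Rightarrow>
     ('a \<Rightarrow> 't) \<Rightarrow> 't \<Rightarrow> 'u"
  where "id_comul V \<Delta> =
    tensor_lift (scale2 V) (scale3 V) (tensor2 V) (\<lambda>x y. tensor_left V x (\<Delta> y))"

definition leibniz_algebra ::
    "('k::field, 'a::ab_group_add, 't::ab_group_add, 'u::ab_group_add) tensor_spaces \<Rightarrow>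
     ('a \<Rightarrow> 'a \<Rightarrow> 'a) \<Rightarrow> bool"
  where "leibniz_algebra V br \<longleftrightarrow>
    bilinear_map (scale1 V) (scale1 V) (scale1 V) br \<and>
    (\<forall>x y z. br x (br y z) = br (br x y) z + br y (br x z))"

definition Lmul :: "('a \<Rightarrow> 'a \<Rightarrow> 'a) \<Rightarrow> 'a \<Rightarrow> 'a \<Rightarrow> 'a"
  where "Lmul br x y = br x y"

definition Rmul :: "('a \<Rightarrow> 'a \<Rightarrow> 'a) \<Rightarrow> 'a \<Rightarrow> 'a \<Rightarrow> 'a"
  where "Rmul br x y = br y x"

definition LRmul :: "('a \<Rightarrow> 'a \<Rightarrow> 'a::ab_group_add) \<Rightarrow> 'a \<Rightarrow> 'a \<Rightarrow> 'a"
  where "LRmul br x y = Lmul br x y + Rmul br x y"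

definition leibniz_coalgebra ::
    "('k::field, 'a::ab_group_add, 't::ab_group_add, 'u::ab_group_add) tensor_spaces \<Rightarrow>
     ('a \<Rightarrow> 't) \<Rightarrow> bool"
  where "leibniz_coalgebra V \<Delta> \<longleftrightarrow>
    Vector_Spaces.linear (scale1 V) (scale2 V) \<Delta> \<and>
    (\<forall>x. comul_id V \<Delta> (\<Delta> x) + flip_id V (id_comul V \<Delta> (\<Delta> x)) - id_comul V \<Delta> (\<Delta> x) = 0)"

definition leibniz_bialgebra ::
    "('k::field, 'a::ab_group_add, 't::ab_group_add, 'u::ab_group_add) tensor_spaces \<Rightarrow>
     ('a \<Rightarrow> 'a \<Rightarrow> 'a) \<Rightarrow> ('a \<Rightarrow> 't) \<Rightarrow> bool"
  where "leibniz_bialgebra V br \<Delta> \<longleftrightarrow>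
    leibniz_algebra V br \<and> leibniz_coalgebra V \<Delta> \<and>
    (\<forall>x y. flip V (tensor_map2 V (Rmul br y) id (\<Delta> x)) = tensor_map2 V (Rmul br x) id (\<Delta> y)) \<and>
    (\<forall>x y. \<Delta> (br x y) =
      (tensor_map2 V id (Rmul br y) (\<Delta> x + flip V (\<Delta> x)) - tensor_map2 V (LRmul br y) id (\<Delta> x + flip V (\<Delta> x)))
      + (tensor_map2 V id (Lmul br x) (\<Delta> y) + tensor_map2 V (Lmul br x) id (\<Delta> y)))"

definition F_op ::
    "('k::field, 'a::ab_group_add, 't::ab_group_add, 'u::ab_group_add) tensor_spaces \<Rightarrow>
     ('a \<Rightarrow> 'a \<Rightarrow> 'a) \<Rightarrow> 'a \<Rightarrow> 't \<Rightarrow> 't"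
  where "F_op V br x t = tensor_map2 V (LRmul br x) id t - tensor_map2 V id (Rmul br x) t"

definition coboundary_comul ::
    "('k::field, 'a::ab_group_add, 't::ab_group_add, 'u::ab_group_add) tensor_spaces \<Rightarrow>
     ('a \<Rightarrow> 'a \<Rightarrow> 'a) \<Rightarrow> 't \<Rightarrow> 'a \<Rightarrow> 't"
  where "coboundary_comul V br r x = F_op V br x r"

text \<open>[[r,r]] for r = \<Sum>i<n. a i \<otimes> b i, defined on the presentation as in the displayed formula.\<close>

definition yang_baxter ::
    "('k::field, 'a::ab_group_add, 't::ab_group_add, 'u::ab_group_add) tensor_spaces \<Rightarrow>
     ('a \<Rightarrow> 'a \<Rightarrow> 'a) \<Rightarrow> nat \<Rightarrow> (nat \<Rightarrow> 'a) \<Rightarrow> (nat \<Rightarrow> 'a) \<Rightarrow> 'u"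
  where "yang_baxter V br n a b = (\<Sum>i<n. \<Sum>j<n.
      br (a i) (a j) \<otimes>\<^sub>2\<^bsub>V\<^esub> b i \<otimes>\<^sub>3\<^bsub>V\<^esub> b j
    - a i \<otimes>\<^sub>2\<^bsub>V\<^esub> (br (b i) (a j) + br (a j) (b i)) \<otimes>\<^sub>3\<^bsub>V\<^esub> b j
    + a i \<otimes>\<^sub>2\<^bsub>V\<^esub> a j \<otimes>\<^sub>3\<^bsub>V\<^esub> br (b j) (b i))"

end

theory Submission
  imports Defs
begin

text \<open>
  Each of the three displayed equations is the defect of one bialgebra axiom for the comultiplication
  \<open>\<Delta> = F(-)r\<close>: up to the Leibniz identity, the left-hand side of the first equation equals the
  coassociativity defect, and that of the third equals the defect of the compatibility of \<open>\<Delta>\<close> with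
  brackets. For the second, \<open>[[x, a] + [a, x], y] = 0\<close> in a left Leibniz algebra, so that
  \<open>(R(y) \<otimes> id) F(x) t = - (R(y) \<otimes> R(x)) t\<close> and the symmetry axiom says that \<open>R(x) \<otimes> R(y)\<close>
  annihilates \<open>r - \<sigma>(r)\<close>. All these are identities between sums of pure tensors, checked after
  rewriting every bracket in right-normed form.
\<close>

section \<open>Linear and bilinear maps, and the universal property of tensor products\<close>

lemma linear_add: "Vector_Spaces.linear s t f \<Longrightarrow> f (x + y) = f x + f y"
  unfolding Vector_Spaces.linear_def by (elim conjE) (rule module_hom.add)

lemma linear_scale: "Vector_Spaces.linear s t f \<Longrightarrow> f (s c x) = t c (f x)"
  unfolding Vector_Spaces.linear_def by (elim conjE) (rule module_hom.scale)

lemma linear_diff: "Vector_Spaces.linear s t f \<Longrightarrow> f (x - y) = f x - f y"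
  unfolding Vector_Spaces.linear_def by (elim conjE) (rule module_hom.diff)

lemma linear_minus: "Vector_Spaces.linear s t f \<Longrightarrow> f (- x) = - f x"
  unfolding Vector_Spaces.linear_def by (elim conjE) (rule module_hom.neg)

lemma linear_zero: "Vector_Spaces.linear s t f \<Longrightarrow> f 0 = 0"
  unfolding Vector_Spaces.linear_def by (elim conjE) (rule module_hom.zero)

lemma linear_sum: "Vector_Spaces.linear s t f \<Longrightarrow> f (\<Sum>i\<in>I. g i) = (\<Sum>i\<in>I. f (g i))"
  unfolding Vector_Spaces.linear_def by (elim conjE) (rule module_hom.sum)

lemmas linear_simps =
  linear_add linear_scale linear_diff linear_minus linear_zero linear_sum

lemma linear_plus:
  assumes "Vector_Spaces.linear s t f" and "Vector_Spaces.linear s t g"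
  shows "Vector_Spaces.linear s t (\<lambda>x. f x + g x)"
proof -
  interpret f: Vector_Spaces.linear s t f by fact
  interpret vector_space_pair s t ..
  show ?thesis using linear_compose_add assms by blast
qed

lemma linear_minus_fun:
  assumes "Vector_Spaces.linear s t f" and "Vector_Spaces.linear s t g"
  shows "Vector_Spaces.linear s t (\<lambda>x. f x - g x)"
proof -
  interpret f: Vector_Spaces.linear s t f by fact
  interpret vector_space_pair s t ..
  show ?thesis using linear_compose_sub assms by blast
qed

lemma linear_scaled:
  assumes "Vector_Spaces.linear s t f"
  shows "Vector_Spaces.linear s t (\<lambda>x. t c (f x))"
proof -
  interpret f: Vector_Spaces.linear s t f by fact
  interpret vector_space_pair s t ..
  show ?thesis using linear_compose_scale_right assms by blast
qed

lemma linear_uminus_fun: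
  assumes "Vector_Spaces.linear s t f"
  shows "Vector_Spaces.linear s t (\<lambda>x. - f x)"
proof -
  interpret f: Vector_Spaces.linear s t f by fact
  interpret vector_space_pair s t ..
  show ?thesis using linear_compose_neg assms by blast
qed

lemma bilinear_map_right: "bilinear_map sA sB sC \<phi> \<Longrightarrow> Vector_Spaces.linear sB sC (\<phi> x)"
  by (simp add: bilinear_map_def)

lemma bilinear_map_left: "bilinear_map sA sB sC \<phi> \<Longrightarrow> Vector_Spaces.linear sA sC (\<lambda>x. \<phi> x y)"
  by (simp add: bilinear_map_def)

lemmas bilinear_map_simps =
  linear_simps[OF bilinear_map_right] linear_simps[OF bilinear_map_left]

lemma bilinear_map_swap:
  "bilinear_map sA sB sC \<phi> \<Longrightarrow> bilinear_map sB sA sC (\<lambda>y x. \<phi> x y)"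
  by (simp add: bilinear_map_def)

lemma bilinear_map_comp:
  assumes "bilinear_map sA sB sC \<phi>"
    and "Vector_Spaces.linear sA' sA f" and "Vector_Spaces.linear sB' sB g"
  shows "bilinear_map sA' sB' sC (\<lambda>x y. \<phi> (f x) (g y))"
  using assms Vector_Spaces.linear_compose[of sA' sA f sC "\<lambda>x. \<phi> x (g y)" for y]
    Vector_Spaces.linear_compose[of sB' sB g sC "\<phi> (f x)" for x]
  by (simp add: bilinear_map_def o_def)

lemma bilinear_map_linear_comp:
  assumes "bilinear_map sA sB sC \<phi>" and "Vector_Spaces.linear sC sD h"
  shows "bilinear_map sA sB sD (\<lambda>x y. h (\<phi> x y))"
  using assms Vector_Spaces.linear_compose[of sA sC "\<lambda>x. \<phi> x y" sD h for y]
    Vector_Spaces.linear_compose[of sB sC "\<phi> x" sD h for x]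
  by (simp add: bilinear_map_def o_def)

text \<open>The universal property supplies the unique map selected by \<open>THE\<close> in
  \<open>tensor_lift\<close>. Every induced map below gets its linearity and its values on pure
  tensors from here.\<close>

lemma
  assumes "is_tensor_product sA sB sT ten" and "bilinear_map sA sB sW \<phi>"
  shows linear_tensor_lift: "Vector_Spaces.linear sT sW (tensor_lift sT sW ten \<phi>)"
    and tensor_lift_tensor: "tensor_lift sT sW ten \<phi> (ten x y) = \<phi> x y"
  using theI'[OF tensor_product_universal[OF assms]]
  unfolding tensor_lift_def by blast+

text \<open>Both maps factor the same bilinear map \<open>h (ten x y)\<close>, so uniqueness
  identifies them. This is what reduces identities between linear maps to pure tensors.\<close>

lemma tensor_product_ext:
  assumes tp: "is_tensor_product sA sB sT ten"
    and g: "Vector_Spaces.linear sT sW g" and h: "Vector_Spaces.linear sT sW h"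
    and eq: "\<And>x y. g (ten x y) = h (ten x y)"
  shows "g t = h t"
proof -
  have "bilinear_map sA sB sT ten" using tp by (simp add: is_tensor_product_def)
  from tensor_product_universal[OF tp bilinear_map_linear_comp[OF this h]]
  have "g = h" using g h eq by blast
  then show ?thesis by simp
qed

section \<open>Induced maps on the tensor square and cube\<close>

locale tensor_cube =
  fixes V :: "('k::field, 'a::ab_group_add, 't::ab_group_add, 'u::ab_group_add) tensor_spaces"
    (structure)
  assumes square: "is_tensor_product (scale1 V) (scale1 V) (scale2 V) (tensor2 V)"
    and cube: "is_tensor_product (scale2 V) (scale1 V) (scale3 V) (tensor3 V)"
begin

abbreviation linear11 where "linear11 \<equiv> Vector_Spaces.linear (scale1 V) (scale1 V)"
abbreviation linear12 where "linear12 \<equiv> Vector_Spaces.linear (scale1 V) (scale2 V)"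
abbreviation linear22 where "linear22 \<equiv> Vector_Spaces.linear (scale2 V) (scale2 V)"
abbreviation linear23 where "linear23 \<equiv> Vector_Spaces.linear (scale2 V) (scale3 V)"
abbreviation linear33 where "linear33 \<equiv> Vector_Spaces.linear (scale3 V) (scale3 V)"

lemma bilinear_tensor2: "bilinear_map (scale1 V) (scale1 V) (scale2 V) (tensor2 V)"
  using square by (simp add: is_tensor_product_def)

lemma bilinear_tensor3: "bilinear_map (scale2 V) (scale1 V) (scale3 V) (tensor3 V)"
  using cube by (simp add: is_tensor_product_def)

lemmas tensor2_simps = bilinear_map_simps[OF bilinear_tensor2]
lemmas tensor3_simps = bilinear_map_simps[OF bilinear_tensor3]

lemma linear_id1: "linear11 id"
  using bilinear_map_right[OF bilinear_tensor2] by (simp add: Vector_Spaces.linear_iff)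

lemma
  assumes "linear11 f" and "linear11 g"
  shows linear_tensor_map2: "linear22 (tensor_map2 V f g)"
    and tensor_map2_tensor: "tensor_map2 V f g (x \<otimes>\<^sub>2 y) = f x \<otimes>\<^sub>2 g y"
  unfolding tensor_map2_def
  using bilinear_map_comp[OF bilinear_tensor2 assms]
  by (rule linear_tensor_lift[OF square] tensor_lift_tensor[OF square])+

lemma
  assumes "linear11 f" and "linear11 g" and "linear11 h"
  shows linear_tensor_map3: "linear33 (tensor_map3 V f g h)"
    and tensor_map3_tensor:
      "tensor_map3 V f g h (t \<otimes>\<^sub>3 z) = tensor_map2 V f g t \<otimes>\<^sub>3 h z"
  unfolding tensor_map3_def
  using bilinear_map_comp[OF bilinear_tensor3 linear_tensor_map2[OF assms(1,2)] assms(3)]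
  by (rule linear_tensor_lift[OF cube] tensor_lift_tensor[OF cube])+

lemma linear_flip: "linear22 (flip V)"
  and flip_tensor: "flip V (x \<otimes>\<^sub>2 y) = y \<otimes>\<^sub>2 x"
  unfolding flip_def using bilinear_map_swap[OF bilinear_tensor2]
  by (rule linear_tensor_lift[OF square] tensor_lift_tensor[OF square])+

lemma linear_flip_id: "linear33 (flip_id V)"
  and flip_id_tensor: "flip_id V (t \<otimes>\<^sub>3 z) = flip V t \<otimes>\<^sub>3 z"
  unfolding flip_id_def
  using bilinear_map_comp[OF bilinear_tensor3 linear_flip linear_id1]
  by (simp_all add: linear_tensor_lift[OF cube] tensor_lift_tensor[OF cube])

lemma linear_tensor_left: "linear23 (tensor_left V x)"
  and tensor_left_tensor: "tensor_left V x (y \<otimes>\<^sub>2 z) = x \<otimes>\<^sub>2 y \<otimes>\<^sub>3 z"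
  unfolding tensor_left_def
  using bilinear_map_comp[OF bilinear_tensor3 bilinear_map_right[OF bilinear_tensor2] linear_id1]
  by (simp_all add: linear_tensor_lift[OF square] tensor_lift_tensor[OF square])

text \<open>Linearity in the second argument is built into the lift. In the first argument,
  additivity and homogeneity compare two linear maps of \<open>t\<close> and need checking only on
  pure tensors. This makes the lift defining \<open>id_comul\<close> legitimate.\<close>

lemma bilinear_tensor_left: "bilinear_map (scale1 V) (scale2 V) (scale3 V) (tensor_left V)"
proof -
  have add: "tensor_left V (x + x') t = tensor_left V x t + tensor_left V x' t" for x x' t
    by (rule tensor_product_ext[OF square linear_tensor_left
          linear_plus[OF linear_tensor_left linear_tensor_left]])
      (simp add: tensor_left_tensor tensor2_simps tensor3_simps)
  have scale: "tensor_left V (scale1 V c x) t = scale3 V c (tensor_left V x t)" for c x t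
    by (rule tensor_product_ext[OF square linear_tensor_left linear_scaled[OF linear_tensor_left]])
      (simp add: tensor_left_tensor tensor2_simps tensor3_simps)
  \<comment> \<open>The record carries bare scalar multiplications; their vector space laws are read
    off from the linearity of \<open>tensor3\<close>.\<close>
  have "vector_space (scale1 V)" "vector_space (scale3 V)"
    using bilinear_map_right[OF bilinear_tensor3] by (auto simp: Vector_Spaces.linear_def)
  then have "Vector_Spaces.linear (scale1 V) (scale3 V) (\<lambda>x. tensor_left V x t)" for t
    by (simp add: Vector_Spaces.linear_iff add scale)
  then show ?thesis by (simp add: bilinear_map_def linear_tensor_left)
qed

lemma
  assumes "linear12 \<Delta>"
  shows linear_comul_id: "linear23 (comul_id V \<Delta>)"
    and comul_id_tensor: "comul_id V \<Delta> (x \<otimes>\<^sub>2 y) = \<Delta> x \<otimes>\<^sub>3 y"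
  unfolding comul_id_def using bilinear_map_comp[OF bilinear_tensor3 assms linear_id1]
  by (simp_all add: linear_tensor_lift[OF square] tensor_lift_tensor[OF square])

lemma
  assumes "linear12 \<Delta>"
  shows linear_id_comul: "linear23 (id_comul V \<Delta>)"
    and id_comul_tensor: "id_comul V \<Delta> (x \<otimes>\<^sub>2 y) = tensor_left V x (\<Delta> y)"
  unfolding id_comul_def using bilinear_map_comp[OF bilinear_tensor_left linear_id1 assms]
  by (simp_all add: linear_tensor_lift[OF square] tensor_lift_tensor[OF square])

lemma flip_tensor_map2:
  assumes f: "linear11 f" and g: "linear11 g"
  shows "flip V (tensor_map2 V f g t) = tensor_map2 V g f (flip V t)"
  using tensor_product_ext[OF square
      Vector_Spaces.linear_compose[OF linear_tensor_map2[OF f g] linear_flip]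
      Vector_Spaces.linear_compose[OF linear_flip linear_tensor_map2[OF g f]]]
  by (simp add: flip_tensor tensor_map2_tensor[OF f g] tensor_map2_tensor[OF g f])

lemmas tensor_simps =
  tensor2_simps tensor3_simps linear_id1
  linear_simps[OF linear_tensor_map2] tensor_map2_tensor
  linear_simps[OF linear_tensor_map3] tensor_map3_tensor
  linear_simps[OF linear_flip] flip_tensor
  linear_simps[OF linear_flip_id] flip_id_tensor
  linear_simps[OF linear_tensor_left] tensor_left_tensor

end

section \<open>The comultiplication induced by \<open>r\<close>\<close>

locale coboundary = tensor_cube V
  for V :: "('k::field, 'a::ab_group_add, 't::ab_group_add, 'u::ab_group_add) tensor_spaces"
    (structure) +
  fixes br :: "'a \<Rightarrow> 'a \<Rightarrow> 'a" and n :: nat and a b :: "nat \<Rightarrow> 'a" and r :: 't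
  assumes leibniz: "leibniz_algebra V br"
    and r: "r = (\<Sum>i<n. a i \<otimes>\<^sub>2 b i)"
begin

abbreviation "F \<equiv> F_op V br"
abbreviation "\<Delta> \<equiv> coboundary_comul V br r"

lemma bilinear_br: "bilinear_map (scale1 V) (scale1 V) (scale1 V) br"
  using leibniz by (simp add: leibniz_algebra_def)

text \<open>The Leibniz identity, oriented as a rewrite rule: it removes every bracket standing in a
  left argument and so produces right-normed form.\<close>

lemma br_br_left: "br (br x y) z = br x (br y z) - br y (br x z)"
  using leibniz unfolding leibniz_algebra_def by (metis add_diff_cancel_right')

lemma linear_Lmul: "linear11 (Lmul br x)"
  using bilinear_map_right[OF bilinear_br] by (simp add: Lmul_def[abs_def])

lemma linear_Rmul: "linear11 (Rmul br x)"
  using bilinear_map_left[OF bilinear_br] by (simp add: Rmul_def[abs_def])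

lemma linear_LRmul: "linear11 (LRmul br x)"
  using linear_plus[OF linear_Lmul linear_Rmul] by (simp add: LRmul_def[abs_def])

text \<open>The sum of both multiplications is symmetric in \<open>x\<close> and \<open>y\<close>,
  so the roles of left and right multiplication are exchanged here.\<close>

lemma linear_LRmul_arg: "linear11 (\<lambda>x. LRmul br x y)"
  using linear_plus[OF linear_Rmul linear_Lmul]
  by (simp add: LRmul_def[abs_def] Lmul_def Rmul_def)

lemma linear_F: "linear22 (F x)"
  unfolding F_op_def[abs_def]
  by (intro linear_minus_fun linear_tensor_map2 linear_LRmul linear_Rmul linear_id1)

lemma F_tensor: "F x (y \<otimes>\<^sub>2 z) = LRmul br x y \<otimes>\<^sub>2 z - y \<otimes>\<^sub>2 br z x"
  by (simp add: F_op_def tensor_map2_tensor linear_LRmul linear_Rmul linear_id1 Rmul_def)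

lemma linear_F_arg: "linear12 (\<lambda>x. F x (y \<otimes>\<^sub>2 z))"
  unfolding F_tensor
  by (intro linear_minus_fun
      bilinear_map_left[OF bilinear_map_comp[OF bilinear_tensor2 linear_LRmul_arg linear_id1], simplified]
      bilinear_map_right[OF bilinear_map_comp[OF bilinear_tensor2 linear_id1 bilinear_map_right[OF bilinear_br]], simplified])

lemma coboundary_comul_sum: "\<Delta> x = (\<Sum>i<n. F x (a i \<otimes>\<^sub>2 b i))"
  by (simp add: coboundary_comul_def r linear_sum[OF linear_F])

lemma linear_coboundary_comul: "linear12 \<Delta>"
proof -
  \<comment> \<open>The tensor of zeros is an arbitrary choice: this instance only provides the
    vector space structures, also when \<open>n = 0\<close> leaves no summand.\<close>
  interpret Vector_Spaces.linear "scale1 V" "scale2 V" "\<lambda>x. F x (0 \<otimes>\<^sub>2 0)"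
    by (rule linear_F_arg)
  interpret vector_space_pair "scale1 V" "scale2 V" ..
  show ?thesis
    unfolding coboundary_comul_sum[abs_def]
    by (rule linear_compose_sum) (simp add: linear_F_arg)
qed

section \<open>Defects of the bialgebra axioms\<close>

lemmas br_simps =
  tensor_simps bilinear_map_simps[OF bilinear_br] br_br_left
  linear_Lmul linear_Rmul linear_LRmul linear_simps[OF linear_F] F_tensor
  Lmul_def Rmul_def LRmul_def

text \<open>In right-normed form, [[x,a],y] = [x,[a,y]] - [a,[x,y]] and [[a,x],y] is its negative,
  so only the second term of \<open>F x\<close> survives.\<close>

lemma Rmul_F: "tensor_map2 V (Rmul br y) id (F x t) = - tensor_map2 V (Rmul br y) (Rmul br x) t"
  by (rule tensor_product_ext[OF square
        Vector_Spaces.linear_compose[OF linear_F linear_tensor_map2[OF linear_Rmul linear_id1],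
          unfolded o_def]
        linear_uminus_fun[OF linear_tensor_map2[OF linear_Rmul linear_Rmul]]])
    (simp add: br_simps)

text \<open>By \<open>Rmul_F\<close>, the axiom at \<open>x\<close>, \<open>y\<close> is the second
  equation with \<open>x\<close> and \<open>y\<close> exchanged, since the flip swaps the two
  factors. Hence the equivalence is between the quantified statements.\<close>

lemma Rmul_comul_symmetric_iff:
  "(\<forall>x y. flip V (tensor_map2 V (Rmul br y) id (\<Delta> x)) = tensor_map2 V (Rmul br x) id (\<Delta> y))
    \<longleftrightarrow> (\<forall>x y. tensor_map2 V (Rmul br y) id (F x (r - flip V r)) = 0)"
  by (auto simp: coboundary_comul_def Rmul_F flip_tensor_map2 linear_Rmul
      linear_simps[OF linear_tensor_map2] linear_simps[OF linear_flip])

text \<open>All terms are linear in \<open>r\<close>, so a single sum over its presentation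
  suffices, and the right-normed expansions of the two sides coincide for every
  \<open>r\<close>.\<close>

lemma comul_derivation_defect:
  fixes x y
  defines "s \<equiv> r - flip V r"
  shows "\<Delta> (br x y) -
      ((tensor_map2 V id (Rmul br y) (\<Delta> x + flip V (\<Delta> x))
          - tensor_map2 V (LRmul br y) id (\<Delta> x + flip V (\<Delta> x)))
        + (tensor_map2 V id (Lmul br x) (\<Delta> y) + tensor_map2 V (Lmul br x) id (\<Delta> y)))
    = tensor_map2 V (Lmul br y) id (flip V (F x s))
      + tensor_map2 V (Rmul br y) id (flip V (F x s) - F x s)
      - flip V (tensor_map2 V (Rmul br y) id (F x s))
      - flip V (tensor_map2 V (Rmul br x) id (F y s))"
  unfolding s_def coboundary_comul_def r
  by (simp add: br_simps sum.distrib sum_subtractf sum_negf algebra_simps)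

text \<open>The copy of \<open>r\<close> in the outer \<Delta> carries the index \<open>j\<close>
  here but \<open>i\<close> in \<open>id_comul_comul\<close>. In both, the third tensor factor is
  then built on \<open>b j\<close>, as in \<open>yang_baxter\<close>, which allows comparison
  summand by summand.\<close>

lemma comul_id_comul:
  "comul_id V \<Delta> (\<Delta> x) = (\<Sum>i<n. \<Sum>j<n.
    F (LRmul br x (a j)) (a i \<otimes>\<^sub>2 b i) \<otimes>\<^sub>3 b j - F (a j) (a i \<otimes>\<^sub>2 b i) \<otimes>\<^sub>3 br (b j) x)"
proof -
  have "comul_id V \<Delta> (\<Delta> x)
      = (\<Sum>j<n. \<Delta> (LRmul br x (a j)) \<otimes>\<^sub>3 b j - \<Delta> (a j) \<otimes>\<^sub>3 br (b j) x)"
    unfolding coboundary_comul_sum[of x]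
    by (simp add: F_tensor linear_simps[OF linear_comul_id] comul_id_tensor
        linear_coboundary_comul)
  also have "\<dots> = (\<Sum>j<n. \<Sum>i<n.
      F (LRmul br x (a j)) (a i \<otimes>\<^sub>2 b i) \<otimes>\<^sub>3 b j - F (a j) (a i \<otimes>\<^sub>2 b i) \<otimes>\<^sub>3 br (b j) x)"
    by (simp add: coboundary_comul_sum tensor3_simps sum_subtractf)
  finally show ?thesis by (subst sum.swap)
qed

lemma id_comul_comul:
  "id_comul V \<Delta> (\<Delta> x) = (\<Sum>i<n. \<Sum>j<n.
    tensor_left V (LRmul br x (a i)) (F (b i) (a j \<otimes>\<^sub>2 b j))
    - tensor_left V (a i) (F (br (b i) x) (a j \<otimes>\<^sub>2 b j)))"
proof -
  have "id_comul V \<Delta> (\<Delta> x)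
      = (\<Sum>i<n. tensor_left V (LRmul br x (a i)) (\<Delta> (b i))
          - tensor_left V (a i) (\<Delta> (br (b i) x)))"
    unfolding coboundary_comul_sum[of x]
    by (simp add: F_tensor linear_simps[OF linear_id_comul] id_comul_tensor
        linear_coboundary_comul)
  then show ?thesis
    by (simp add: coboundary_comul_sum linear_simps[OF linear_tensor_left] sum_subtractf)
qed

text \<open>All terms are quadratic in \<open>r\<close>. Both sides are written as double sums over
  the presentation and compared at fixed \<open>i\<close> and \<open>j\<close>.\<close>

lemma coassociativity_defect:
  fixes x
  defines "s \<equiv> r - flip V r"
    and "rr \<equiv> yang_baxter V br n a b"
  defines "w \<equiv> flip_id V rr - (\<Sum>j<n. F (a j) s \<otimes>\<^sub>3 b j)"
  shows "comul_id V \<Delta> (\<Delta> x) + flip_id V (id_comul V \<Delta> (\<Delta> x)) - id_comul V \<Delta> (\<Delta> x)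
    = (tensor_map3 V id id (Rmul br x) w - tensor_map3 V id (LRmul br x) id w)
      + tensor_map3 V (LRmul br x) id id rr
      + (\<Sum>j<n. tensor_map3 V (LRmul br (a j)) id id (flip V (F x s) \<otimes>\<^sub>3 b j))"
proof -
  \<comment> \<open>\<open>Y\<close>, \<open>S\<close> and \<open>W\<close> are the summands of
    \<open>rr\<close>, \<open>s\<close> and \<open>w\<close>; \<open>C\<close> and \<open>E\<close>
    are those of the left-hand and right-hand sides.\<close>
  define Y where "Y i j = br (a i) (a j) \<otimes>\<^sub>2 b i \<otimes>\<^sub>3 b j
    - a i \<otimes>\<^sub>2 (br (b i) (a j) + br (a j) (b i)) \<otimes>\<^sub>3 b j
    + a i \<otimes>\<^sub>2 a j \<otimes>\<^sub>3 br (b j) (b i)" for i j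
  define S where "S i = a i \<otimes>\<^sub>2 b i - b i \<otimes>\<^sub>2 a i" for i
  define W where "W i j = flip_id V (Y i j) - F (a j) (S i) \<otimes>\<^sub>3 b j" for i j
  define C where "C i j =
      (F (LRmul br x (a j)) (a i \<otimes>\<^sub>2 b i) \<otimes>\<^sub>3 b j - F (a j) (a i \<otimes>\<^sub>2 b i) \<otimes>\<^sub>3 br (b j) x)
      + (flip_id V (tensor_left V (LRmul br x (a i)) (F (b i) (a j \<otimes>\<^sub>2 b j))
          - tensor_left V (a i) (F (br (b i) x) (a j \<otimes>\<^sub>2 b j))))
      - (tensor_left V (LRmul br x (a i)) (F (b i) (a j \<otimes>\<^sub>2 b j))
          - tensor_left V (a i) (F (br (b i) x) (a j \<otimes>\<^sub>2 b j)))" for i j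
  define E where "E i j =
      (tensor_map3 V id id (Rmul br x) (W i j) - tensor_map3 V id (LRmul br x) id (W i j))
      + tensor_map3 V (LRmul br x) id id (Y i j)
      + tensor_map3 V (LRmul br (a j)) id id (flip V (F x (S i)) \<otimes>\<^sub>3 b j)" for i j
  \<comment> \<open>The two sides agree summand by summand, except that rewriting \<open>[[b\<^sub>j, b\<^sub>i], x]\<close> in right-normed
    form leaves a term antisymmetric in \<open>i\<close> and \<open>j\<close>.\<close>
  define H where "H i j = a i \<otimes>\<^sub>2 a j \<otimes>\<^sub>3 br (b j) (br (b i) x)" for i j
  have s: "s = (\<Sum>i<n. S i)"
    unfolding s_def r S_def by (simp add: tensor_simps sum_subtractf)
  have rr: "rr = (\<Sum>i<n. \<Sum>j<n. Y i j)"
    unfolding rr_def yang_baxter_def Y_def ..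
  \<comment> \<open>The correction in \<open>w\<close> sums over \<open>j\<close> outside and over
    the terms of \<open>s\<close> inside; the swap aligns it with \<open>rr\<close>.\<close>
  have w: "w = (\<Sum>i<n. \<Sum>j<n. W i j)"
    unfolding w_def rr s W_def
    by (simp add: tensor_simps linear_simps[OF linear_F] sum_subtractf
        sum.swap[of "\<lambda>i j. F (a j) (S i) \<otimes>\<^sub>3 b j"])
  have "(\<Sum>j<n. tensor_map3 V (LRmul br (a j)) id id (flip V (F x s) \<otimes>\<^sub>3 b j))
    = (\<Sum>i<n. \<Sum>j<n. tensor_map3 V (LRmul br (a j)) id id (flip V (F x (S i)) \<otimes>\<^sub>3 b j))"
    unfolding s
    by (subst sum.swap) (simp add: tensor_simps linear_simps[OF linear_F] linear_LRmul)
  then have E: "(tensor_map3 V id id (Rmul br x) w - tensor_map3 V id (LRmul br x) id w)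
      + tensor_map3 V (LRmul br x) id id rr
      + (\<Sum>j<n. tensor_map3 V (LRmul br (a j)) id id (flip V (F x s) \<otimes>\<^sub>3 b j))
    = (\<Sum>i<n. \<Sum>j<n. E i j)"
    unfolding w rr E_def
    by (simp add: linear_simps[OF linear_tensor_map3] linear_id1 linear_Rmul linear_LRmul
        sum.distrib sum_subtractf)
  \<comment> \<open>The term \<open>- H i j\<close> comes from the subtracted
    \<open>id_comul\<close> part of \<open>C\<close>, and \<open>H j i\<close> from applying the
    Leibniz identity in \<open>E\<close>.\<close>
  have "C i j = E i j + (H j i - H i j)" for i j
    unfolding C_def E_def H_def W_def Y_def S_def
    by (simp add: br_simps algebra_simps)
  then have "(\<Sum>i<n. \<Sum>j<n. C i j)
      = (\<Sum>i<n. \<Sum>j<n. E i j) + ((\<Sum>i<n. \<Sum>j<n. H j i) - (\<Sum>i<n. \<Sum>j<n. H i j))"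
    by (simp add: sum.distrib sum_subtractf)
  also have "(\<Sum>i<n. \<Sum>j<n. H j i) = (\<Sum>i<n. \<Sum>j<n. H i j)"
    by (rule sum.swap)
  finally have "(\<Sum>i<n. \<Sum>j<n. C i j) = (\<Sum>i<n. \<Sum>j<n. E i j)"
    by simp
  moreover have "comul_id V \<Delta> (\<Delta> x) + flip_id V (id_comul V \<Delta> (\<Delta> x)) - id_comul V \<Delta> (\<Delta> x)
      = (\<Sum>i<n. \<Sum>j<n. C i j)"
    unfolding comul_id_comul id_comul_comul C_def
    by (simp add: linear_simps[OF linear_flip_id] sum.distrib sum_subtractf)
  ultimately show ?thesis
    using E by simp
qed

end

theorem corollary2p9:
  fixes V :: "('k::{alg_closed_field, field_char_0}, 'a::ab_group_add, 't::ab_group_add,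
      'u::ab_group_add) tensor_spaces" (structure)
    and br :: "'a \<Rightarrow> 'a \<Rightarrow> 'a"
    and n :: nat and a b :: "nat \<Rightarrow> 'a" and r :: 't
  assumes "fd_tensor_spaces V"
    and "leibniz_algebra V br"
    and "r = (\<Sum>i<n. a i \<otimes>\<^sub>2 b i)"
  shows
    "(leibniz_bialgebra V br (coboundary_comul V br r) \<longleftrightarrow>
      (\<forall>x y.
        (let F = F_op V br; R = Rmul br; LR = LRmul br; s = r - flip V r;
             rr = yang_baxter V br n a b;
             w = flip_id V rr - (\<Sum>j<n. F (a j) s \<otimes>\<^sub>3 b j)
         in (tensor_map3 V id id (R x) w - tensor_map3 V id (LR x) id w)
            + tensor_map3 V (LR x) id id rr
            + (\<Sum>j<n. tensor_map3 V (LR (a j)) id id (flip V (F x s) \<otimes>\<^sub>3 b j)) = 0) \<and>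
        (let F = F_op V br; R = Rmul br; s = r - flip V r
         in tensor_map2 V (R y) id (F x s) = 0) \<and>
        (let F = F_op V br; L = Lmul br; R = Rmul br; s = r - flip V r
         in tensor_map2 V (L y) id (flip V (F x s))
            + tensor_map2 V (R y) id (flip V (F x s) - F x s)
            - flip V (tensor_map2 V (R y) id (F x s))
            - flip V (tensor_map2 V (R x) id (F y s)) = 0)))
     \<and>
     (yang_baxter V br n a b = 0 \<and> (\<forall>x. F_op V br x (r - flip V r) = 0)
        \<longrightarrow> leibniz_bialgebra V br (coboundary_comul V br r))"
proof -
  interpret coboundary V br n a b r
    using assms by unfold_locales (auto simp: fd_tensor_spaces_def)
  \<comment> \<open>Coassociativity and the bracket axiom are stated as vanishing defects, so that
    the two defect identities rewrite them into the first and third equations.\<close>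
  have iff: "leibniz_bialgebra V br \<Delta> \<longleftrightarrow>
    (\<forall>x. comul_id V \<Delta> (\<Delta> x) + flip_id V (id_comul V \<Delta> (\<Delta> x)) - id_comul V \<Delta> (\<Delta> x) = 0) \<and>
    (\<forall>x y. tensor_map2 V (Rmul br y) id (F x (r - flip V r)) = 0) \<and>
    (\<forall>x y. \<Delta> (br x y) -
      ((tensor_map2 V id (Rmul br y) (\<Delta> x + flip V (\<Delta> x))
          - tensor_map2 V (LRmul br y) id (\<Delta> x + flip V (\<Delta> x)))
        + (tensor_map2 V id (Lmul br x) (\<Delta> y) + tensor_map2 V (Lmul br x) id (\<Delta> y))) = 0)"
    unfolding leibniz_bialgebra_def leibniz_coalgebra_def Rmul_comul_symmetric_iff right_minus_eq
    using leibniz linear_coboundary_comul by blast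
  note iff = iff[unfolded coassociativity_defect comul_derivation_defect]
  \<comment> \<open>Under these hypotheses \<open>w\<close> vanishes too, and every term of the
    three equations is a linear image of zero.\<close>
  have "leibniz_bialgebra V br \<Delta>"
    if "yang_baxter V br n a b = 0" and "\<forall>x. F x (r - flip V r) = 0"
    unfolding iff using that
    by (simp add: tensor_simps linear_LRmul linear_Rmul linear_Lmul)
  with iff show ?thesis unfolding Let_def by blast
qed

end
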